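(* Let $k\ge1$ be an integer, $z^*\in\mathbb{R}^k$, $\delta\in(0,k(2k+1)]$, and $\gamma\in[\nu,1)$, where $$\nu:=\sqrt{\frac{1+\frac{1}{4k^2(2k+1)^2}}{1+\frac{1}{k^2(2k+1)^2}}}=\sqrt{\frac{4k^2(2k+1)^2+1}{4k^2(2k+1)^2+4}} .$$ For these values of $z^*,\gamma,\delta$, let $A_\gamma\in\mathbb{R}^{(2k^2+k)\times k}$ and $b\in\mathbb{R}^{2k^2+k}$ be the matrix and vector defined in the context, and consider the problem $\min_z\|A_\gamma z-b\|_1$, which has unique solution $z^*$. Define $$\alpha:=\gamma\,\frac{k+1}{k}\qquad\text{and}\qquad \xi:=\gamma\sqrt{1+\frac{1}{k^2(2k+1)^2}} .$$ Then $$\alpha>1,\qquad \xi\ge\sqrt{1+\frac{1}{4k^2(2k+1)^2}}>1,\qquad \frac{\gamma}{k(2k+1)\sqrt{\xi^2-1}}>1 .$$ Initialize $\epsilon_0:=1$ and $z^0\in\mathbb{R}^k_{++}$ componentwise by $$z^0_1\in\left(z^*_1+\frac{\delta}{\alpha+\gamma/\big(k(2k+1)\sqrt{\xi^2-1}\big)},\ \ z^*_1+\frac{\delta}{\alpha+1}\right),\qquad z^0_i:=z^*_i\quad(i=2,\dots,k).$$ If $\{z^n\}$ is the sequence generated by the $\ell_1$R-IRLS algorithm, described in the context, with $A=A_\gamma$, this $b$, $K=k$, $N=2k^2+k$ and this initialization, then $z^n\nrightarrow z^*$.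
   Context: $\mathbb{R}^k_{++}$ denotes the vectors in $\mathbb{R}^k$ with all components positive. The matrix $A_\gamma$. Let $\tilde A:=(I_k,\dots,I_k)^T\in\mathbb{R}^{(2k^2+k)\times k}$ be the vertical stack of $2k+1$ copies of the $k\times k$ identity matrix. $A_\gamma$ is obtained from $\tilde A$ by replacing the $(ik+1,1)$ entry by $\frac{k+1}{k}\gamma$ for each $0\le i\le k-1$ (i.e. the $(1,1)$ entry of each of the first $k$ identity blocks), all other entries being unchanged. The vector $b$. $b:=A_\gamma z^*+\delta\tilde e$, where $\tilde e:=\sum_{j=0}^{k-1}e_{jk+1}$ and $e_i$ is the $i$-th standard unit vector of $\mathbb{R}^{2k^2+k}$. $\ell_1$R-IRLS algorithm (the Daubechies–DeVore–Fornasier–Güntürk IRLS algorithm transcribed to $\ell_1$ regression, via $x^n=Az^n-b$). For $x\in\mathbb{R}^N$ let $r_i(x)$ denote the $i$-th largest element (counted with multiplicity) of $|x_1|,\dots,|x_N|$. Given $A\in\mathbb{R}^{N\times k}$ with rows $a_i^T$, $b\in\mathbb{R}^N$, a positive integer $K$, and $z^0,\epsilon_0$, for $n=0,1,2,\dots$ set $$z^{n+1}:=\operatorname{argmin}_z\sum_{i=1}^N\frac{(a_i^Tz-b_i)^2}{\sqrt{(a_i^Tz^n-b_i)^2+\epsilon_n^2}},\qquad \epsilon_{n+1}:=\min\left\{\epsilon_n,\ \frac{r_{K+1}(Az^{n+1}-b)}{N}\right\}.$$ *)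

theory Defs
  imports Complex_Main "HOL-Analysis.L2_Norm" "Jordan_Normal_Form.Matrix"
begin

text \<open>
  Vectors and matrices are those of Jordan_Normal_Form, with the dimension carried by the object, so
  indices start at 0: entry \<open>(i,j)\<close> of the mathematical text is \<open>A $$ (i-1, j-1)\<close>.
\<close>

definition l1_norm :: "real vec \<Rightarrow> real" where
  "l1_norm x = (\<Sum>i<dim_vec x. \<bar>x $ i\<bar>)"

text \<open>The type \<open>real vec\<close> carries no topology, so convergence is spelled out in the Euclidean norm.\<close>

definition converges_to :: "(nat \<Rightarrow> real vec) \<Rightarrow> real vec \<Rightarrow> bool" where
  "converges_to z w \<longleftrightarrow> (\<lambda>n. L2_set (\<lambda>i. z n $ i - w $ i) {..<dim_vec w}) \<longlonglongrightarrow> 0"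

text \<open>The \<open>i\<close>-th largest, for \<open>1 \<le> i \<le> dim_vec x\<close>, of the absolute values of the entries.\<close>

definition kth_largest_abs :: "nat \<Rightarrow> real vec \<Rightarrow> real" where
  "kth_largest_abs i x = rev (sort (map abs (list_of_vec x))) ! (i - 1)"

definition irls_objective :: "real mat \<Rightarrow> real vec \<Rightarrow> real vec \<Rightarrow> real \<Rightarrow> real vec \<Rightarrow> real" where
  "irls_objective A b y e v =
     (\<Sum>i<dim_row A. (row A i \<bullet> v - b $ i)\<^sup>2 / sqrt ((row A i \<bullet> y - b $ i)\<^sup>2 + e\<^sup>2))"

text \<open>
  \<open>z\<close> and \<open>eps\<close> are iterates of the algorithm started at \<open>z 0\<close> and \<open>eps 0\<close>.  Every
  minimiser is admitted as the next iterate; it is unique when \<open>eps n > 0\<close> and \<open>A\<close> has full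
  column rank.  If \<open>eps n = 0\<close>, summands with vanishing residual count as 0 because
  \<open>x / 0 = 0\<close>; the mathematical formula is undefined in that case.
\<close>

definition l1R_IRLS ::
  "real mat \<Rightarrow> real vec \<Rightarrow> nat \<Rightarrow> (nat \<Rightarrow> real vec) \<Rightarrow> (nat \<Rightarrow> real) \<Rightarrow> bool" where
  "l1R_IRLS A b K z eps \<longleftrightarrow>
     z 0 \<in> carrier_vec (dim_col A) \<and>
     (\<forall>n. is_arg_min (irls_objective A b (z n) (eps n)) (\<lambda>v. v \<in> carrier_vec (dim_col A)) (z (Suc n)) \<and>
          eps (Suc n) =
            min (eps n) (kth_largest_abs (K + 1) (A *\<^sub>v z (Suc n) - b) / real (dim_row A)))"

definition A_tilde :: "nat \<Rightarrow> real mat" where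
  "A_tilde k = mat (2 * k\<^sup>2 + k) k (\<lambda>(i, j). 1\<^sub>m k $$ (i mod k, j))"

definition A_gamma :: "nat \<Rightarrow> real \<Rightarrow> real mat" where
  "A_gamma k \<gamma> = mat (2 * k\<^sup>2 + k) k (\<lambda>(i, j).
     if j = 0 \<and> (\<exists>l<k. i = l * k) then (real k + 1) / real k * \<gamma> else A_tilde k $$ (i, j))"

definition e_tilde :: "nat \<Rightarrow> real vec" where
  "e_tilde k = finsum_vec TYPE(real) (2 * k\<^sup>2 + k) (\<lambda>j. unit_vec (2 * k\<^sup>2 + k) (j * k)) {..<k}"

definition b_vec :: "nat \<Rightarrow> real \<Rightarrow> real vec \<Rightarrow> real \<Rightarrow> real vec" where
  "b_vec k \<gamma> zs \<delta> = A_gamma k \<gamma> *\<^sub>v zs + \<delta> \<cdot>\<^sub>v e_tilde k"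

end

theory Submission imports Defs begin

text \<open>
  Only the first coordinate moves.  Put \<open>u\<^sub>n = z\<^sub>n $ 0 - zs $ 0\<close> and let
  \<open>q\<^sub>n = (\<delta> - \<alpha> u\<^sub>n) / u\<^sub>n\<close> be the ratio of the two kinds of nonzero residuals, so that
  \<open>u\<^sub>n = \<delta> / (\<alpha> + q\<^sub>n)\<close>.  With \<open>t = eps\<^sub>n / u\<^sub>n\<close> one step of the algorithm reads
  \<open>q\<^sub>n\<^sub>+\<^sub>1 = sqrt ((q\<^sub>n\<^sup>2 + t\<^sup>2) / (1 + t\<^sup>2)) / \<gamma>\<close>.  As long as \<open>q\<^sub>n > 1\<close>, the
  \<open>(k + 1)\<close>-st largest residual is \<open>u\<^sub>n\<close>; if moreover \<open>q\<^sub>n\<close> increases for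
  \<open>n \<ge> 1\<close>, then \<open>t = 1 / N\<close> for all \<open>n \<ge> 1\<close> (\<open>\<delta> \<le> N\<close> ensures \<open>u\<^sub>1 / N \<le> eps\<^sub>0\<close>), and the recursion becomes
  \<open>q\<^sub>n\<^sub>+\<^sub>1\<^sup>2 = (q\<^sub>n\<^sup>2 + 1 / N\<^sup>2) / \<xi>\<^sup>2\<close>, an increasing contraction with fixed point
  \<open>Q = 1 / (N sqrt (\<xi>\<^sup>2 - 1))\<close>.  The initialisation means \<open>1 < q\<^sub>0 < \<gamma> Q\<close>, and the first step
  gives \<open>q\<^sub>1 < q\<^sub>0 / \<gamma> < Q\<close>.  Hence \<open>q\<^sub>n\<close> increases for \<open>n \<ge> 1\<close> but stays below \<open>Q\<close>, and
  \<open>u\<^sub>n\<close> stays above \<open>\<delta> / (\<alpha> + Q)\<close>.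
\<close>

section \<open>Order statistics by counting\<close>

lemma card_filter_mset_cong:
  assumes "mset xs = mset ys"
  shows "card {i. i < length xs \<and> P (xs ! i)} = card {i. i < length ys \<and> P (ys ! i)}"
proof -
  have "size (filter_mset P (mset xs)) = size (filter_mset P (mset ys))"
    using assms by simp
  then show ?thesis
    by (metis length_filter_conv_card mset_filter size_mset)
qed

text \<open>The number of entries beyond a threshold is invariant under permutation, so counts taken
  on \<open>x\<close> transfer to the sorted list, where monotonicity turns them into the value at
  position \<open>K - 1\<close>. Order statistics thus need only counting, not an explicit
  sorting.\<close>

lemma kth_largest_abs_eqI:
  assumes gt: "card {i. i < dim_vec x \<and> c < \<bar>x $ i\<bar>} < K"
    and ge: "K \<le> card {i. i < dim_vec x \<and> c \<le> \<bar>x $ i\<bar>}"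
  shows "kth_largest_abs K x = c"
proof -
  define s where "s = rev (sort (map abs (list_of_vec x)))"
  have len: "length s = dim_vec x" by (simp add: s_def)
  have card_s: "card {i. i < length s \<and> P (s ! i)} = card {i. i < dim_vec x \<and> P \<bar>x $ i\<bar>}" for P
  proof -
    have "card {i. i < length s \<and> P (s ! i)} =
        card {i. i < length (map abs (list_of_vec x)) \<and> P (map abs (list_of_vec x) ! i)}"
      by (rule card_filter_mset_cong) (simp add: s_def)
    also have "{i. i < length (map abs (list_of_vec x)) \<and> P (map abs (list_of_vec x) ! i)} =
        {i. i < dim_vec x \<and> P \<bar>x $ i\<bar>}"
      by (auto simp: list_of_vec_index)
    finally show ?thesis .
  qed
  have "card {i. i < dim_vec x \<and> c \<le> \<bar>x $ i\<bar>} \<le> card {..<dim_vec x}"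
    by (intro card_mono) auto
  \<comment> \<open>\<open>gt\<close> rules out \<open>K = 0\<close> and \<open>ge\<close> bounds
    \<open>K\<close> by the length, so position \<open>K - 1\<close> is a genuine index.\<close>
  with gt ge have K: "1 \<le> K" "K - 1 < length s" using len by auto
  have "sorted (rev s)" by (simp add: s_def)
  then have anti: "s ! j \<le> s ! i" if "i \<le> j" "j < length s" for i j
    using that by (simp add: sorted_rev_iff_nth_mono)
  \<comment> \<open>A larger value at this position would put \<open>K\<close> entries above
    \<open>c\<close>; in the second half, a smaller one would leave at most \<open>K - 1\<close>
    entries reaching \<open>c\<close>.\<close>
  have "\<not> c < s ! (K - 1)"
  proof
    assume "c < s ! (K - 1)"
    moreover have "s ! (K - 1) \<le> s ! i" if "i < K" for i
      using that K by (intro anti) auto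
    ultimately have "{..<K} \<subseteq> {i. i < length s \<and> c < s ! i}"
      using K by fastforce
    from card_mono[OF _ this] gt show False by (simp add: card_s)
  qed
  moreover have "\<not> s ! (K - 1) < c"
  proof
    assume "s ! (K - 1) < c"
    then have "i < K - 1" if "i < length s" "c \<le> s ! i" for i
      using that anti[of "K - 1" i] by fastforce
    then have "{i. i < length s \<and> c \<le> s ! i} \<subseteq> {..<K - 1}" by auto
    from card_mono[OF _ this] ge K show False by (simp add: card_s)
  qed
  ultimately show ?thesis by (simp add: kth_largest_abs_def s_def)
qed

section \<open>Splitting the rows into \<open>2 * k + 1\<close> blocks of length
  \<open>k\<close>\<close>

text \<open>Only the heads of blocks distinguish the first \<open>k\<close> blocks from the other
  \<open>k + 1\<close>; elsewhere a summand depends on its position in the block alone. Both the l1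
  norm of the residual and the weighted objective have this shape.\<close>

lemma sum_blocks:
  fixes f d :: "nat \<Rightarrow> real"
  assumes k: "1 \<le> k"
    and f: "\<And>l j. l < 2 * k + 1 \<Longrightarrow> j < k \<Longrightarrow>
      f (l * k + j) = (if j = 0 then if l < k then a else c else d j)"
  shows "(\<Sum>i<2 * k\<^sup>2 + k. f i) = real k * a + (real k + 1) * c + (2 * real k + 1) * (\<Sum>j\<in>{1..<k}. d j)"
proof -
  have N: "2 * k\<^sup>2 + k = (2 * k + 1) * k" by (simp add: power2_eq_square algebra_simps)
  have block: "sum f {l * k..<l * k + k} = (if l < k then a else c) + (\<Sum>j\<in>{1..<k}. d j)"
    if "l < 2 * k + 1" for l
  proof -
    have "sum f {l * k..<l * k + k} = (\<Sum>j\<in>{0..<k}. f (l * k + j))"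
      using sum.shift_bounds_nat_ivl[of f 0 "l * k" k] by (simp add: add.commute)
    also have "\<dots> = f (l * k) + (\<Sum>j\<in>{1..<k}. f (l * k + j))"
      using k by (simp add: sum.atLeast_Suc_lessThan)
    also have "f (l * k) = (if l < k then a else c)"
      using f[OF that, of 0] k by simp
    also have "(\<Sum>j\<in>{1..<k}. f (l * k + j)) = (\<Sum>j\<in>{1..<k}. d j)"
      using f[OF that] by (intro sum.cong) auto
    finally show ?thesis .
  qed
  have "(\<Sum>i<2 * k\<^sup>2 + k. f i) = (\<Sum>l<2 * k + 1. sum f {l * k..<l * k + k})"
    unfolding N by (rule sum.nat_group[symmetric])
  also have "\<dots> = (\<Sum>l<2 * k + 1. (if l < k then a else c) + (\<Sum>j\<in>{1..<k}. d j))"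
    using block by (intro sum.cong) auto
  also have "\<dots> = (\<Sum>l<2 * k + 1. if l < k then a else c) + (2 * real k + 1) * (\<Sum>j\<in>{1..<k}. d j)"
    by (simp add: sum.distrib algebra_simps)
  also have "(\<Sum>l<2 * k + 1. if l < k then a else c) = real k * a + (real k + 1) * c"
  proof -
    have "{..<2 * k + 1} \<inter> {l. l < k} = {..<k}" "{..<2 * k + 1} \<inter> - {l. l < k} = {k..<2 * k + 1}"
      by auto
    then show ?thesis by (simp add: sum.If_cases del: sum.lessThan_Suc)
  qed
  finally show ?thesis .
qed

lemma block_index_less: "l * k + j < 2 * k\<^sup>2 + k" if "l < 2 * k + 1" "j < k" for l k j :: nat
proof -
  have "l * k + j < (l + 1) * k" using that by simp
  also have "\<dots> \<le> (2 * k + 1) * k" using that by (intro mult_right_mono) auto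
  finally show ?thesis by (simp add: power2_eq_square algebra_simps)
qed

lemma block_index_cases:
  fixes i k :: nat
  assumes "i < 2 * k\<^sup>2 + k"
  obtains l j where "i = l * k + j" "l < 2 * k + 1" "j < k"
proof -
  from assms have "k > 0" by (cases k) auto
  moreover have "i div k < 2 * k + 1"
    using assms by (simp add: less_mult_imp_div_less power2_eq_square algebra_simps)
  ultimately show thesis using that[of "i div k" "i mod k"] by simp
qed

text \<open>Uniqueness of quotient and remainder; it decides the existential condition in
  \<open>A_gamma\<close>.\<close>

lemma block_head_iff:
  fixes j k l :: nat
  assumes "j < k"
  shows "(\<exists>l'<n. l * k + j = l' * k) \<longleftrightarrow> j = 0 \<and> l < n"
proof
  assume "\<exists>l'<n. l * k + j = l' * k"
  then obtain l' where l': "l' < n" "l * k + j = l' * k" by auto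
  have "(l * k + j) mod k = j" "(l * k + j) div k = l" using assms by auto
  with l' assms show "j = 0 \<and> l < n" by auto
qed auto

section \<open>Residuals and objectives in block form\<close>

lemma dim_row_A_gamma [simp]: "dim_row (A_gamma k \<gamma>) = 2 * k\<^sup>2 + k"
  and dim_col_A_gamma [simp]: "dim_col (A_gamma k \<gamma>) = k"
  by (simp_all add: A_gamma_def)

lemma row_A_gamma:
  assumes l: "l < 2 * k + 1" and j: "j < k" and z: "z \<in> carrier_vec k"
  shows "row (A_gamma k \<gamma>) (l * k + j) \<bullet> z =
    (if j = 0 \<and> l < k then (real k + 1) / real k * \<gamma> else 1) * z $ j"
proof -
  note i = block_index_less[OF l j]
  have entry: "A_gamma k \<gamma> $$ (l * k + j, m) =
      (if m = j then if j = 0 \<and> l < k then (real k + 1) / real k * \<gamma> else 1 else 0)"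
    if "m < k" for m
    using i j that block_head_iff[OF j, of k l] by (auto simp: A_gamma_def A_tilde_def)
  have "row (A_gamma k \<gamma>) (l * k + j) \<bullet> z = (\<Sum>m<k. A_gamma k \<gamma> $$ (l * k + j, m) * z $ m)"
    using i z by (simp add: scalar_prod_def row_def atLeast0LessThan)
  also have "\<dots> = (\<Sum>m<k. if m = j
      then (if j = 0 \<and> l < k then (real k + 1) / real k * \<gamma> else 1) * z $ j else 0)"
    using entry by (intro sum.cong) auto
  finally show ?thesis using j by simp
qed

lemma e_tilde_nth:
  assumes l: "l < 2 * k + 1" and j: "j < k"
  shows "e_tilde k $ (l * k + j) = (if j = 0 \<and> l < k then 1 else 0)"
proof -
  note i = block_index_less[OF l j]
  have "e_tilde k $ (l * k + j) = (\<Sum>l'<k. unit_vec (2 * k\<^sup>2 + k) (l' * k) $ (l * k + j))"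
    unfolding e_tilde_def using i by (intro index_finsum_vec) auto
  also have "\<dots> = (\<Sum>l'<k. if l' = l then if j = 0 then 1 else 0 else 0)"
  proof (intro sum.cong refl)
    fix l' assume "l' \<in> {..<k}"
    then have "l' * k < 2 * k\<^sup>2 + k" using block_index_less[of l' k 0] j by auto
    moreover have "l * k + j = l' * k \<longleftrightarrow> l' = l \<and> j = 0"
    proof
      assume eq: "l * k + j = l' * k"
      have "(l * k + j) mod k = j" "(l * k + j) div k = l" using j by auto
      with eq j show "l' = l \<and> j = 0" by auto
    qed auto
    ultimately show "unit_vec (2 * k\<^sup>2 + k) (l' * k) $ (l * k + j) =
        (if l' = l then if j = 0 then 1 else (0::real) else 0)"
      using i by auto
  qed
  finally show ?thesis by simp
qed

lemma dim_e_tilde [simp]: "dim_vec (e_tilde k) = 2 * k\<^sup>2 + k"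
  using finsum_vec_closed[of "\<lambda>j. unit_vec (2 * k\<^sup>2 + k) (j * k) :: real vec" "{..<k}" "2 * k\<^sup>2 + k"]
  by (simp add: e_tilde_def Pi_I)

lemma dim_b_vec [simp]: "dim_vec (b_vec k \<gamma> zs \<delta>) = 2 * k\<^sup>2 + k"
  by (simp add: b_vec_def)

text \<open>By linearity the \<open>zs\<close> part of \<open>b_vec\<close> cancels, so the residual
  depends on \<open>z\<close> only through the error \<open>z - zs\<close>, and \<delta> survives
  only in the \<open>k\<close> modified rows.\<close>

lemma residual_nth:
  assumes l: "l < 2 * k + 1" and j: "j < k"
    and z: "z \<in> carrier_vec k" and zs: "zs \<in> carrier_vec k"
    and \<alpha>: "\<alpha> = \<gamma> * ((real k + 1) / real k)"
  shows "row (A_gamma k \<gamma>) (l * k + j) \<bullet> z - b_vec k \<gamma> zs \<delta> $ (l * k + j) =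
    (if j = 0 then if l < k then \<alpha> * (z $ 0 - zs $ 0) - \<delta> else z $ 0 - zs $ 0 else z $ j - zs $ j)"
proof -
  have "b_vec k \<gamma> zs \<delta> $ (l * k + j) =
      row (A_gamma k \<gamma>) (l * k + j) \<bullet> zs + \<delta> * e_tilde k $ (l * k + j)"
    using block_index_less[OF l j] by (simp add: b_vec_def)
  then show ?thesis
    using row_A_gamma[OF l j z] row_A_gamma[OF l j zs] e_tilde_nth[OF l j]
    by (auto simp: \<alpha> right_diff_distrib diff_divide_distrib mult.commute)
qed

lemma residual_vec_nth:
  assumes "l < 2 * k + 1" and "j < k" and "z \<in> carrier_vec k" and "zs \<in> carrier_vec k"
    and "\<alpha> = \<gamma> * ((real k + 1) / real k)"
  shows "(A_gamma k \<gamma> *\<^sub>v z - b_vec k \<gamma> zs \<delta>) $ (l * k + j) =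
    (if j = 0 then if l < k then \<alpha> * (z $ 0 - zs $ 0) - \<delta> else z $ 0 - zs $ 0 else z $ j - zs $ j)"
  using residual_nth[OF assms, of \<delta>] block_index_less[OF assms(1,2)] by simp

lemma l1_norm_residual:
  assumes k: "1 \<le> k" and z: "z \<in> carrier_vec k" and zs: "zs \<in> carrier_vec k"
    and \<alpha>: "\<alpha> = \<gamma> * ((real k + 1) / real k)"
  shows "l1_norm (A_gamma k \<gamma> *\<^sub>v z - b_vec k \<gamma> zs \<delta>) =
    real k * \<bar>\<alpha> * (z $ 0 - zs $ 0) - \<delta>\<bar> + (real k + 1) * \<bar>z $ 0 - zs $ 0\<bar>
      + (2 * real k + 1) * (\<Sum>j\<in>{1..<k}. \<bar>z $ j - zs $ j\<bar>)"
  unfolding l1_norm_def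
  by (simp only: index_minus_vec dim_b_vec, rule sum_blocks[OF k])
     (simp add: residual_vec_nth[OF _ _ z zs \<alpha>] del: index_minus_vec)

lemma irls_objective_A_gamma:
  assumes k: "1 \<le> k" and v: "v \<in> carrier_vec k" and y: "y \<in> carrier_vec k"
    and zs: "zs \<in> carrier_vec k" and \<alpha>: "\<alpha> = \<gamma> * ((real k + 1) / real k)"
  shows "irls_objective (A_gamma k \<gamma>) (b_vec k \<gamma> zs \<delta>) y e v =
    real k * ((\<alpha> * (v $ 0 - zs $ 0) - \<delta>)\<^sup>2 / sqrt ((\<alpha> * (y $ 0 - zs $ 0) - \<delta>)\<^sup>2 + e\<^sup>2))
      + (real k + 1) * ((v $ 0 - zs $ 0)\<^sup>2 / sqrt ((y $ 0 - zs $ 0)\<^sup>2 + e\<^sup>2))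
      + (2 * real k + 1) * (\<Sum>j\<in>{1..<k}. (v $ j - zs $ j)\<^sup>2 / sqrt ((y $ j - zs $ j)\<^sup>2 + e\<^sup>2))"
  unfolding irls_objective_def dim_row_A_gamma
  by (rule sum_blocks[OF k])
     (simp add: residual_nth[OF _ _ v zs \<alpha>] residual_nth[OF _ _ y zs \<alpha>])

section \<open>The unique l1 minimiser\<close>

text \<open>An error \<open>u\<close> in the first coordinate gains at most \<open>k * \<alpha> *
  \<bar>u\<bar> = (k + 1) * \<gamma> * \<bar>u\<bar>\<close> on the modified rows and costs
  \<open>(k + 1) * \<bar>u\<bar>\<close> on the other heads. As \<gamma> < 1 this is a net loss, and
  errors in other coordinates only add to it.\<close>

lemma l1_regression_unique_solution:
  assumes k: "1 \<le> k" and zs: "zs \<in> carrier_vec k" and \<delta>: "0 \<le> \<delta>" and \<gamma>: "0 \<le> \<gamma>" "\<gamma> < 1"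
  shows "is_arg_min (\<lambda>z. l1_norm (A_gamma k \<gamma> *\<^sub>v z - b_vec k \<gamma> zs \<delta>)) (\<lambda>z. z \<in> carrier_vec k) v
    \<longleftrightarrow> v = zs"
proof -
  define \<alpha> where "\<alpha> = \<gamma> * ((real k + 1) / real k)"
  define F where "F = (\<lambda>z. l1_norm (A_gamma k \<gamma> *\<^sub>v z - b_vec k \<gamma> zs \<delta>))"
  have F_zs: "F zs = real k * \<delta>"
    unfolding F_def using l1_norm_residual[OF k zs zs \<alpha>_def, of \<delta>] \<delta> by simp
  have lower: "F z \<ge> real k * \<delta> + (real k + 1) * (1 - \<gamma>) * \<bar>z $ 0 - zs $ 0\<bar>
      + (2 * real k + 1) * (\<Sum>j\<in>{1..<k}. \<bar>z $ j - zs $ j\<bar>)" if z: "z \<in> carrier_vec k" for z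
  proof -
    have "\<alpha> \<ge> 0" using \<gamma> by (simp add: \<alpha>_def)
    then have "\<bar>\<alpha> * (z $ 0 - zs $ 0) - \<delta>\<bar> \<ge> \<delta> - \<alpha> * \<bar>z $ 0 - zs $ 0\<bar>"
      using abs_mult[of \<alpha> "z $ 0 - zs $ 0"] by simp
    then have "real k * \<bar>\<alpha> * (z $ 0 - zs $ 0) - \<delta>\<bar> \<ge> real k * (\<delta> - \<alpha> * \<bar>z $ 0 - zs $ 0\<bar>)"
      by (intro mult_left_mono) auto
    also have "real k * (\<delta> - \<alpha> * \<bar>z $ 0 - zs $ 0\<bar>) =
        real k * \<delta> - (real k + 1) * \<gamma> * \<bar>z $ 0 - zs $ 0\<bar>"
      using k by (simp add: \<alpha>_def field_simps)
    finally show ?thesis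
      unfolding F_def l1_norm_residual[OF k z zs \<alpha>_def] by (simp add: algebra_simps)
  qed
  have unique: "z = zs" if z: "z \<in> carrier_vec k" and le: "F z \<le> F zs" for z
  proof (rule eq_vecI)
    have S: "(\<Sum>j\<in>{1..<k}. \<bar>z $ j - zs $ j\<bar>) \<ge> 0" by (intro sum_nonneg) auto
    have P: "0 \<le> (real k + 1) * (1 - \<gamma>) * \<bar>z $ 0 - zs $ 0\<bar>"
      and Q: "0 \<le> (2 * real k + 1) * (\<Sum>j\<in>{1..<k}. \<bar>z $ j - zs $ j\<bar>)"
      using \<gamma> S by auto
    then have "(real k + 1) * (1 - \<gamma>) * \<bar>z $ 0 - zs $ 0\<bar> = 0"
      and "(2 * real k + 1) * (\<Sum>j\<in>{1..<k}. \<bar>z $ j - zs $ j\<bar>) = 0"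
      using lower[OF z] le F_zs by linarith+
    then have "z $ 0 = zs $ 0" "(\<Sum>j\<in>{1..<k}. \<bar>z $ j - zs $ j\<bar>) = 0"
      using \<gamma> by (auto simp: add_eq_0_iff_both_eq_0)
    moreover from this(2) have "\<forall>j\<in>{1..<k}. z $ j = zs $ j"
      by (subst (asm) sum_nonneg_eq_0_iff) auto
    ultimately show "z $ i = zs $ i" if "i < dim_vec zs" for i
      using that zs by (cases "i = 0") auto
  qed (use z zs in auto)
  have min: "F zs \<le> F z" if "z \<in> carrier_vec k" for z
  proof -
    have "0 \<le> (\<Sum>j\<in>{1..<k}. \<bar>z $ j - zs $ j\<bar>)" by (intro sum_nonneg) auto
    then have "0 \<le> (real k + 1) * (1 - \<gamma>) * \<bar>z $ 0 - zs $ 0\<bar>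
      + (2 * real k + 1) * (\<Sum>j\<in>{1..<k}. \<bar>z $ j - zs $ j\<bar>)"
      using \<gamma> by (intro add_nonneg_nonneg) auto
    with lower[OF that] F_zs show ?thesis by linarith
  qed
  show ?thesis
    unfolding F_def[symmetric] is_arg_min_linorder using unique min zs by blast
qed

section \<open>One step of the algorithm\<close>

text \<open>With zero tail, only the \<open>k\<close> modified rows can exceed the first-coordinate
  error, while the heads of all \<open>2 * k + 1\<close> blocks reach it; counting then locates the
  order statistic.\<close>

lemma kth_largest_abs_residual:
  assumes k: "1 \<le> k" and z: "z \<in> carrier_vec k" and zs: "zs \<in> carrier_vec k"
    and \<alpha>: "\<alpha> = \<gamma> * ((real k + 1) / real k)"
    and tail: "\<forall>j\<in>{1..<k}. z $ j = zs $ j"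
    and u: "0 \<le> z $ 0 - zs $ 0" "z $ 0 - zs $ 0 \<le> \<bar>\<alpha> * (z $ 0 - zs $ 0) - \<delta>\<bar>"
  shows "kth_largest_abs (k + 1) (A_gamma k \<gamma> *\<^sub>v z - b_vec k \<gamma> zs \<delta>) = z $ 0 - zs $ 0"
proof (rule kth_largest_abs_eqI)
  let ?r = "A_gamma k \<gamma> *\<^sub>v z - b_vec k \<gamma> zs \<delta>"
  have dim: "dim_vec ?r = 2 * k\<^sup>2 + k" by simp
  note r = residual_vec_nth[OF _ _ z zs \<alpha>, of _ _ \<delta>]
  have "{i. i < dim_vec ?r \<and> z $ 0 - zs $ 0 < \<bar>?r $ i\<bar>} \<subseteq> (\<lambda>l. l * k) ` {..<k}"
  proof
    fix i assume "i \<in> {i. i < dim_vec ?r \<and> z $ 0 - zs $ 0 < \<bar>?r $ i\<bar>}"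
    then have i: "i < 2 * k\<^sup>2 + k" "z $ 0 - zs $ 0 < \<bar>?r $ i\<bar>" using dim by auto
    from i(1) obtain l j where lj: "i = l * k + j" "l < 2 * k + 1" "j < k"
      by (rule block_index_cases)
    have "j = 0 \<and> l < k"
      using i(2) u tail lj(2,3) unfolding lj(1) r[OF lj(2,3)] by (auto split: if_splits)
    then show "i \<in> (\<lambda>l. l * k) ` {..<k}" using lj by auto
  qed
  then have "card {i. i < dim_vec ?r \<and> z $ 0 - zs $ 0 < \<bar>?r $ i\<bar>} \<le> card ((\<lambda>l. l * k) ` {..<k})"
    by (intro card_mono) auto
  also have "\<dots> \<le> k" using card_image_le[of "{..<k}" "\<lambda>l. l * k"] by simp
  finally show "card {i. i < dim_vec ?r \<and> z $ 0 - zs $ 0 < \<bar>?r $ i\<bar>} < k + 1" by simp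
  have "(\<lambda>l. l * k) ` {..<k + 1 + k} \<subseteq> {i. i < dim_vec ?r \<and> z $ 0 - zs $ 0 \<le> \<bar>?r $ i\<bar>}"
  proof (rule image_subsetI)
    fix l assume "l \<in> {..<k + 1 + k}"
    then have l: "l < 2 * k + 1" by simp
    show "l * k \<in> {i. i < dim_vec ?r \<and> z $ 0 - zs $ 0 \<le> \<bar>?r $ i\<bar>}"
      using block_index_less[OF l, of 0] r[OF l, of 0] k u dim by auto
  qed
  then have "card ((\<lambda>l. l * k) ` {..<k + 1 + k}) \<le>
      card {i. i < dim_vec ?r \<and> z $ 0 - zs $ 0 \<le> \<bar>?r $ i\<bar>}"
    by (intro card_mono) auto
  moreover have "card ((\<lambda>l. l * k) ` {..<k + 1 + k}) = k + 1 + k"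
    using k by (subst card_image) (auto simp: inj_on_def)
  ultimately show "k + 1 \<le> card {i. i < dim_vec ?r \<and> z $ 0 - zs $ 0 \<le> \<bar>?r $ i\<bar>}" by simp
qed

text \<open>The objective decouples over the coordinates. The tail is a positively weighted sum of
  squares vanishing at \<open>zs\<close>; the first coordinate contributes a quadratic, minimised by
  completing the square.\<close>

lemma irls_argmin:
  assumes k: "1 \<le> k" and y: "y \<in> carrier_vec k" and zs: "zs \<in> carrier_vec k"
    and \<alpha>: "\<alpha> = \<gamma> * ((real k + 1) / real k)" and \<gamma>: "0 < \<gamma>" and e: "0 < e"
    and w1: "w1 = sqrt ((\<alpha> * (y $ 0 - zs $ 0) - \<delta>)\<^sup>2 + e\<^sup>2)"
    and w2: "w2 = sqrt ((y $ 0 - zs $ 0)\<^sup>2 + e\<^sup>2)"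
    and min: "is_arg_min (irls_objective (A_gamma k \<gamma>) (b_vec k \<gamma> zs \<delta>) y e)
      (\<lambda>v. v \<in> carrier_vec k) v"
  shows "v $ 0 = zs $ 0 + \<delta> / (\<alpha> + w1 / (\<gamma> * w2))" and "\<forall>j\<in>{1..<k}. v $ j = zs $ j"
proof -
  define w where "w = (\<lambda>j. sqrt ((y $ j - zs $ j)\<^sup>2 + e\<^sup>2))"
  define u where "u = \<delta> / (\<alpha> + w1 / (\<gamma> * w2))"
  \<comment> \<open>The explicit minimiser; comparing \<open>v\<close> with it suffices. Next,
    \<open>c\<close> is the leading coefficient of the quadratic in the first coordinate.\<close>
  define p where "p = vec k (\<lambda>j. if j = 0 then zs $ 0 + u else zs $ j)"
  define c where "c = real k * \<alpha>\<^sup>2 / w1 + (real k + 1) / w2"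
  define x where "x = v $ 0 - zs $ 0"
  define S where "S = (\<Sum>j\<in>{1..<k}. (v $ j - zs $ j)\<^sup>2 / w j)"
  \<comment> \<open>Positivity of \<open>e\<close> keeps every weight finite, even where a residual
    vanishes.\<close>
  have pos: "w1 > 0" "w2 > 0" "w j > 0" for j
    using e by (auto simp: w1 w2 w_def intro!: add_nonneg_pos)
  have "\<alpha> > 0" using k \<gamma> by (simp add: \<alpha>)
  have k\<alpha>: "real k * \<alpha> = \<gamma> * (real k + 1)" using k by (simp add: \<alpha>)
  have c: "c > 0" using pos k \<open>\<alpha> > 0\<close> by (simp add: c_def add_pos_pos)
  have v: "v \<in> carrier_vec k" and p: "p \<in> carrier_vec k"
    using min by (auto simp: is_arg_min_def p_def)
  have le: "irls_objective (A_gamma k \<gamma>) (b_vec k \<gamma> zs \<delta>) y e v \<le>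
      irls_objective (A_gamma k \<gamma>) (b_vec k \<gamma> zs \<delta>) y e p"
    using min p by (auto simp: is_arg_min_linorder)
  \<comment> \<open>The identity \<open>k\<alpha>\<close> lets \<open>c\<close> factor through the
    denominator of \<open>u\<close>, so that \<open>cu\<close> becomes the stationarity
    condition.\<close>
  have "real k * \<alpha>\<^sup>2 = (real k + 1) * \<alpha> * \<gamma>"
    using k\<alpha> by (simp add: power2_eq_square mult.commute mult.left_commute)
  then have c': "c = (real k + 1) * \<gamma> * (\<alpha> + w1 / (\<gamma> * w2)) / w1"
    using pos \<gamma> by (simp add: c_def field_simps)
  have "\<alpha> + w1 / (\<gamma> * w2) > 0" using pos \<gamma> \<open>\<alpha> > 0\<close> by (simp add: add_pos_pos)
  then have cu: "c * u = real k * \<alpha> * \<delta> / w1"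
    unfolding c' u_def k\<alpha> by simp
  have p_nth: "p $ 0 - zs $ 0 = u" "(\<Sum>j\<in>{1..<k}. (p $ j - zs $ j)\<^sup>2 / w j) = 0"
    using k by (auto simp: p_def intro!: sum.neutral)
  have quad: "real k * ((\<alpha> * t - \<delta>)\<^sup>2 / w1) + (real k + 1) * (t\<^sup>2 / w2)
      = c * (t - u)\<^sup>2 + real k * \<delta>\<^sup>2 / w1 - c * u\<^sup>2" for t
  proof -
    have "real k * ((\<alpha> * t - \<delta>)\<^sup>2 / w1) + (real k + 1) * (t\<^sup>2 / w2)
        = c * t\<^sup>2 - 2 * t * (real k * \<alpha> * \<delta> / w1) + real k * \<delta>\<^sup>2 / w1"
      using pos by (simp add: c_def power2_eq_square field_simps)
    then show ?thesis
      unfolding cu[symmetric] by (simp add: power2_eq_square algebra_simps)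
  qed
  \<comment> \<open>The constants of \<open>quad\<close> cancel, and both the square and the tail
    sum vanish at \<open>p\<close>.\<close>
  have "c * (x - u)\<^sup>2 + (2 * real k + 1) * S \<le> 0"
    using le unfolding irls_objective_A_gamma[OF k v y zs \<alpha>] irls_objective_A_gamma[OF k p y zs \<alpha>]
      w1[symmetric] w2[symmetric] p_nth(1) p_nth(2)[unfolded w_def] quad x_def S_def w_def by simp
  moreover have "0 \<le> S"
    unfolding S_def using pos(3) by (intro sum_nonneg divide_nonneg_pos) auto
  moreover have "0 \<le> c * (x - u)\<^sup>2" using c by simp
  moreover have "0 \<le> (2 * real k + 1) * S" using \<open>0 \<le> S\<close> by simp
  ultimately have 0: "c * (x - u)\<^sup>2 = 0" "(2 * real k + 1) * S = 0" by linarith+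
  from 0(1) c show "v $ 0 = zs $ 0 + \<delta> / (\<alpha> + w1 / (\<gamma> * w2))" by (simp add: x_def u_def)
  have "2 * real k + 1 \<noteq> 0" by linarith
  with 0(2) have "S = 0" by simp
  then have "\<forall>j\<in>{1..<k}. (v $ j - zs $ j)\<^sup>2 / w j = 0"
    unfolding S_def by (subst (asm) sum_nonneg_eq_0_iff) (auto intro: divide_nonneg_pos pos(3))
  then show "\<forall>j\<in>{1..<k}. v $ j = zs $ j" using less_imp_neq[OF pos(3)] by fastforce
qed

text \<open>When \<open>e\<close> is \<open>t\<close> times the first-coordinate error, that error
  factors out of both weights, so their quotient depends on \<open>q\<close> and \<open>t\<close>
  only. From \<open>q > 1\<close> the radicand exceeds 1, and dividing by \<gamma> < 1 keeps
  \<open>q' > 1\<close>, which makes the new error the required order statistic.\<close>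

lemma irls_ratio_step:
  assumes k: "1 \<le> k" and y: "y \<in> carrier_vec k" and zs: "zs \<in> carrier_vec k"
    and \<alpha>: "\<alpha> = \<gamma> * ((real k + 1) / real k)" and \<gamma>: "0 < \<gamma>" "\<gamma> < 1" and \<delta>: "0 < \<delta>"
    and t: "0 < t" and q: "1 < q" and y0: "y $ 0 = zs $ 0 + \<delta> / (\<alpha> + q)"
    and e: "e = t * (\<delta> / (\<alpha> + q))"
    and q': "q' = sqrt ((q\<^sup>2 + t\<^sup>2) / (1 + t\<^sup>2)) / \<gamma>"
    and min: "is_arg_min (irls_objective (A_gamma k \<gamma>) (b_vec k \<gamma> zs \<delta>) y e)
      (\<lambda>v. v \<in> carrier_vec k) v"
  shows "v $ 0 = zs $ 0 + \<delta> / (\<alpha> + q')" and "\<forall>j\<in>{1..<k}. v $ j = zs $ j" and "1 < q'"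
    and "kth_largest_abs (k + 1) (A_gamma k \<gamma> *\<^sub>v v - b_vec k \<gamma> zs \<delta>) = \<delta> / (\<alpha> + q')"
proof -
  define u where "u = \<delta> / (\<alpha> + q)"
  have "\<alpha> > 0" using k \<gamma> by (simp add: \<alpha>)
  then have u: "u > 0" using \<delta> q by (simp add: u_def)
  \<comment> \<open>For general \<open>s\<close>, since it serves both the old ratio
    \<open>q\<close> and the new ratio \<open>q'\<close>.\<close>
  have ratio: "\<alpha> * (\<delta> / (\<alpha> + s)) - \<delta> = - (s * (\<delta> / (\<alpha> + s)))" if "1 < s" for s
    using that \<open>\<alpha> > 0\<close> by (simp add: field_simps)
  have yu: "y $ 0 - zs $ 0 = u" by (simp add: y0 u_def)
  have "(\<alpha> * u - \<delta>)\<^sup>2 + e\<^sup>2 = u\<^sup>2 * (q\<^sup>2 + t\<^sup>2)"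
    unfolding ratio[OF q, folded u_def] e u_def[symmetric] by (simp add: power2_eq_square algebra_simps)
  then have w1: "sqrt ((\<alpha> * (y $ 0 - zs $ 0) - \<delta>)\<^sup>2 + e\<^sup>2) = u * sqrt (q\<^sup>2 + t\<^sup>2)"
    using u by (simp add: yu real_sqrt_mult)
  have "u\<^sup>2 + e\<^sup>2 = u\<^sup>2 * (1 + t\<^sup>2)"
    by (simp add: e u_def[symmetric] power2_eq_square algebra_simps)
  then have w2: "sqrt ((y $ 0 - zs $ 0)\<^sup>2 + e\<^sup>2) = u * sqrt (1 + t\<^sup>2)"
    using u by (simp add: yu real_sqrt_mult)
  have "u * sqrt (q\<^sup>2 + t\<^sup>2) / (\<gamma> * (u * sqrt (1 + t\<^sup>2))) = q'"
    using u by (simp add: q' real_sqrt_divide)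
  moreover have "e > 0" using mult_pos_pos[OF t u] by (simp add: e u_def)
  ultimately show v0: "v $ 0 = zs $ 0 + \<delta> / (\<alpha> + q')" and tail: "\<forall>j\<in>{1..<k}. v $ j = zs $ j"
    using irls_argmin[OF k y zs \<alpha> \<gamma>(1) _ w1[symmetric] w2[symmetric] min] by auto
  have "1 < q\<^sup>2" using q by simp
  then have "1 < (q\<^sup>2 + t\<^sup>2) / (1 + t\<^sup>2)" by (simp add: add_pos_nonneg)
  then have "1 < sqrt ((q\<^sup>2 + t\<^sup>2) / (1 + t\<^sup>2))" by simp
  with \<gamma>(2) have "\<gamma> < sqrt ((q\<^sup>2 + t\<^sup>2) / (1 + t\<^sup>2))" by linarith
  with \<gamma>(1) show q'1: "1 < q'" unfolding q' by simp
  have v: "v \<in> carrier_vec k" using min by (auto simp: is_arg_min_def)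
  have u': "0 < \<delta> / (\<alpha> + q')" using \<delta> \<open>\<alpha> > 0\<close> q'1 by simp
  then have "1 * (\<delta> / (\<alpha> + q')) \<le> q' * (\<delta> / (\<alpha> + q'))"
    using q'1 by (intro mult_right_mono) auto
  then have "\<delta> / (\<alpha> + q') \<le> \<bar>\<alpha> * (\<delta> / (\<alpha> + q')) - \<delta>\<bar>"
    unfolding ratio[OF q'1] using u' by linarith
  then show "kth_largest_abs (k + 1) (A_gamma k \<gamma> *\<^sub>v v - b_vec k \<gamma> zs \<delta>) = \<delta> / (\<alpha> + q')"
    using kth_largest_abs_residual[OF k v zs \<alpha> tail, of \<delta>] u' by (simp add: v0)
qed

section \<open>The invariant along the iteration and non-convergence\<close>

lemma irls_not_convergent:
  assumes k: "1 \<le> k" and zs: "zs \<in> carrier_vec k"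
    and \<delta>: "0 < \<delta>" "\<delta> \<le> N" and N: "N = real k * (2 * real k + 1)"
    and \<gamma>: "0 < \<gamma>" "\<gamma> < 1" and \<alpha>: "\<alpha> = \<gamma> * ((real k + 1) / real k)"
    and \<xi>: "\<xi> = \<gamma> * sqrt (1 + 1 / N\<^sup>2)" and \<xi>1: "1 < \<xi>"
    and irls: "l1R_IRLS (A_gamma k \<gamma>) (b_vec k \<gamma> zs \<delta>) k z eps" and eps0: "eps 0 = 1"
    and z0: "z 0 $ 0 \<in> {zs $ 0 + \<delta> / (\<alpha> + \<gamma> / (N * sqrt (\<xi>\<^sup>2 - 1))) <..< zs $ 0 + \<delta> / (\<alpha> + 1)}"
  shows "\<not> converges_to z zs"
proof -
  define Q where "Q = 1 / (N * sqrt (\<xi>\<^sup>2 - 1))"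
  have N0: "N \<ge> 3"
  proof -
    have "1 * 3 \<le> real k * (2 * real k + 1)" using k by (intro mult_mono) auto
    then show ?thesis by (simp add: N)
  qed
  have rows: "real (dim_row (A_gamma k \<gamma>)) = N" by (simp add: N power2_eq_square algebra_simps)
  have \<alpha>0: "\<alpha> > 0" using k \<gamma> by (simp add: \<alpha>)
  have s: "\<xi>\<^sup>2 - 1 > 0" using \<xi>1 by simp
  have Q0: "Q > 0" using s N0 by (simp add: Q_def)
  \<comment> \<open>The fixed point equation of the recursion for the squared ratio,
    rearranged.\<close>
  have Q2: "Q\<^sup>2 * (\<xi>\<^sup>2 - 1) = 1 / N\<^sup>2"
    using s N0 by (simp add: Q_def power_divide power_mult_distrib)
  have \<xi>2: "\<xi>\<^sup>2 = \<gamma>\<^sup>2 * (1 + (1 / N)\<^sup>2)"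
    by (simp add: \<xi> power_mult_distrib power_divide)
  have step: "is_arg_min (irls_objective (A_gamma k \<gamma>) (b_vec k \<gamma> zs \<delta>) (z n) (eps n))
        (\<lambda>v. v \<in> carrier_vec k) (z (Suc n))"
    and eps: "eps (Suc n) = min (eps n)
        (kth_largest_abs (k + 1) (A_gamma k \<gamma> *\<^sub>v z (Suc n) - b_vec k \<gamma> zs \<delta>) / N)" for n
    using irls unfolding l1R_IRLS_def rows by auto
  have z: "z n \<in> carrier_vec k" for n
    using irls step by (cases n) (auto simp: l1R_IRLS_def is_arg_min_def)
  \<comment> \<open>The invariant starts at \<open>Suc n\<close> because \<open>eps 0 = 1\<close>
    need not be the error divided by \<open>N\<close>. Monotonicity of the ratio is not carried
    along: each step rederives it from \<open>q < Q\<close>.\<close>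
  have inv: "\<exists>q. 1 < q \<and> q < Q \<and> z (Suc n) $ 0 = zs $ 0 + \<delta> / (\<alpha> + q) \<and>
      eps (Suc n) = 1 / N * (\<delta> / (\<alpha> + q))" for n
  proof (induction n)
    case 0
    define u where "u = z 0 $ 0 - zs $ 0"
    define q where "q = \<delta> / u - \<alpha>"
    define q' where "q' = sqrt ((q\<^sup>2 + (1 / u)\<^sup>2) / (1 + (1 / u)\<^sup>2)) / \<gamma>"
    have ub: "\<delta> / (\<alpha> + \<gamma> * Q) < u" "u < \<delta> / (\<alpha> + 1)"
      using z0 by (auto simp: u_def Q_def)
    have "0 < \<delta> / (\<alpha> + \<gamma> * Q)" using \<delta> \<alpha>0 \<gamma> Q0 by (simp add: add_pos_pos)
    with ub have u0: "u > 0" by linarith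
    have "\<alpha> + \<gamma> * Q > 0" using \<alpha>0 \<gamma> Q0 by (simp add: add_pos_pos)
    then have q: "1 < q" "q < \<gamma> * Q"
      using ub u0 \<alpha>0 by (simp_all add: q_def field_simps)
    have uq: "\<delta> / (\<alpha> + q) = u" using u0 \<delta> by (simp add: q_def)
    have zu: "z 0 $ 0 = zs $ 0 + \<delta> / (\<alpha> + q)" unfolding uq by (simp add: u_def)
    \<comment> \<open>The first step has \<open>t = 1 / u\<close>, which fits
      \<open>eps 0 = 1\<close> into the general step.\<close>
    have eu: "eps 0 = 1 / u * (\<delta> / (\<alpha> + q))" unfolding uq eps0 using u0 by simp
    have t0: "0 < 1 / u" using u0 by simp
    note ratio = irls_ratio_step[OF k z zs \<alpha> \<gamma> \<delta>(1) t0 q(1) zu eu q'_def step]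
    \<comment> \<open>The radicand is a weighted mean of \<open>q\<^sup>2\<close> and 1, hence at
      most \<open>q\<^sup>2\<close>.\<close>
    have "q\<^sup>2 + (1 / u)\<^sup>2 \<le> q\<^sup>2 * (1 + (1 / u)\<^sup>2)"
    proof -
      have "1 * (1 / u)\<^sup>2 \<le> q\<^sup>2 * (1 / u)\<^sup>2" using q by (intro mult_right_mono) auto
      then show ?thesis by (simp add: algebra_simps)
    qed
    then have "(q\<^sup>2 + (1 / u)\<^sup>2) / (1 + (1 / u)\<^sup>2) \<le> q\<^sup>2"
      by (subst divide_le_eq) (auto simp: add_pos_nonneg)
    then have "sqrt ((q\<^sup>2 + (1 / u)\<^sup>2) / (1 + (1 / u)\<^sup>2)) \<le> q"
      using q by (intro real_le_lsqrt) auto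
    then have "q' < Q" using q \<gamma> by (simp add: q'_def divide_less_eq mult.commute)
    moreover have "eps (Suc 0) = 1 / N * (\<delta> / (\<alpha> + q'))"
    proof -
      \<comment> \<open>The new error is at most \<delta>, hence at most \<open>N\<close>, so the
        minimum with \<open>eps 0 = 1\<close> selects the error divided by \<open>N\<close>.\<close>
      have "\<delta> / (\<alpha> + q') \<le> \<delta> / 1"
        using \<delta> \<alpha>0 ratio(3) by (intro divide_left_mono) auto
      then have "\<delta> / (\<alpha> + q') \<le> N" using \<delta> by simp
      then have "\<delta> / (\<alpha> + q') / N \<le> 1" using N0 by (subst divide_le_eq_1_pos) auto
      then show ?thesis using eps[of 0] unfolding ratio(4) eps0 by simp
    qed
    ultimately show ?case using ratio by blast
  next
    case (Suc n)
    then obtain q where q: "1 < q" "q < Q" "z (Suc n) $ 0 = zs $ 0 + \<delta> / (\<alpha> + q)"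
      "eps (Suc n) = 1 / N * (\<delta> / (\<alpha> + q))" by blast
    define q' where "q' = sqrt ((q\<^sup>2 + (1 / N)\<^sup>2) / (1 + (1 / N)\<^sup>2)) / \<gamma>"
    have t0: "0 < 1 / N" using N0 by simp
    note ratio = irls_ratio_step[OF k z zs \<alpha> \<gamma> \<delta>(1) t0 q(1) q(3,4) q'_def step]
    have "q'\<^sup>2 = (q\<^sup>2 + (1 / N)\<^sup>2) / (1 + (1 / N)\<^sup>2) / \<gamma>\<^sup>2"
      unfolding q'_def power_divide by (subst real_sqrt_pow2) (auto intro!: divide_nonneg_nonneg)
    also have "\<dots> = (q\<^sup>2 + (1 / N)\<^sup>2) / \<xi>\<^sup>2"
      unfolding \<xi>2 by (simp add: mult.commute)
    \<comment> \<open>Written with \<open>Q\<close>, this gives \<open>(q'\<^sup>2 - q\<^sup>2) *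
      \<xi>\<^sup>2 = (Q\<^sup>2 - q\<^sup>2) * (\<xi>\<^sup>2 - 1)\<close> and \<open>(Q\<^sup>2 -
      q'\<^sup>2) * \<xi>\<^sup>2 = Q\<^sup>2 - q\<^sup>2\<close>; both right-hand sides are
      positive.\<close>
    finally have q'2: "q'\<^sup>2 * \<xi>\<^sup>2 = q\<^sup>2 + Q\<^sup>2 * (\<xi>\<^sup>2 - 1)"
      using \<xi>1 Q2 by (simp add: power_divide)
    have qQ: "q\<^sup>2 < Q\<^sup>2" using q by (intro power_strict_mono) auto
    have "q\<^sup>2 * (\<xi>\<^sup>2 - 1) < Q\<^sup>2 * (\<xi>\<^sup>2 - 1)" using qQ s by (rule mult_strict_right_mono)
    then have "q\<^sup>2 * \<xi>\<^sup>2 < q'\<^sup>2 * \<xi>\<^sup>2" unfolding q'2 by (simp add: algebra_simps)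
    then have "q\<^sup>2 < q'\<^sup>2" using \<xi>1 by (auto simp: mult_less_cancel_right)
    then have qq': "q < q'" using ratio(3) by (intro power_less_imp_less_base[of q 2 q']) auto
    have "q'\<^sup>2 * \<xi>\<^sup>2 < Q\<^sup>2 * \<xi>\<^sup>2" unfolding q'2 using qQ by (simp add: algebra_simps)
    then have "q'\<^sup>2 < Q\<^sup>2" using \<xi>1 by (auto simp: mult_less_cancel_right)
    then have "q' < Q" using Q0 by (intro power_less_imp_less_base[of q' 2 Q]) auto
    moreover have "eps (Suc (Suc n)) = 1 / N * (\<delta> / (\<alpha> + q'))"
    proof -
      \<comment> \<open>A larger ratio means a smaller error, so the minimum defining
        \<open>eps\<close> takes the new value.\<close>
      have "\<delta> / (\<alpha> + q') \<le> \<delta> / (\<alpha> + q)"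
        using \<delta> \<alpha>0 q(1) qq' by (intro divide_left_mono) auto
      then have "\<delta> / (\<alpha> + q') / N \<le> \<delta> / (\<alpha> + q) / N" using N0 by (intro divide_right_mono) auto
      then show ?thesis using eps[of "Suc n"] unfolding ratio(4) q(4) by (simp add: mult.commute)
    qed
    ultimately show ?case using ratio by blast
  qed
  define L where "L = \<delta> / (\<alpha> + Q)"
  have L: "L > 0" using \<delta> \<alpha>0 Q0 by (simp add: L_def)
  have far: "L \<le> L2_set (\<lambda>i. z (Suc n) $ i - zs $ i) {..<dim_vec zs}" for n
  proof -
    obtain q where q: "1 < q" "q < Q" "z (Suc n) $ 0 = zs $ 0 + \<delta> / (\<alpha> + q)" using inv by blast
    have "L \<le> \<delta> / (\<alpha> + q)" unfolding L_def using \<delta> \<alpha>0 q by (intro divide_left_mono) auto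
    also have "\<dots> = \<bar>z (Suc n) $ 0 - zs $ 0\<bar>" using q \<delta> \<alpha>0 by simp
    \<comment> \<open>Applying the bound to absolute values controls the modulus; squaring makes the
      two norms agree.\<close>
    also have "\<dots> \<le> L2_set (\<lambda>i. z (Suc n) $ i - zs $ i) {..<dim_vec zs}"
      using k zs member_le_L2_set[of "{..<dim_vec zs}" 0 "\<lambda>i. \<bar>z (Suc n) $ i - zs $ i\<bar>"]
      by (simp add: L2_set_def)
    finally show ?thesis .
  qed
  show ?thesis
  proof
    assume "converges_to z zs"
    then have "(\<lambda>n. L2_set (\<lambda>i. z (Suc n) $ i - zs $ i) {..<dim_vec zs}) \<longlonglongrightarrow> 0"
      unfolding converges_to_def by (rule LIMSEQ_Suc)
    then have "L \<le> 0" by (rule LIMSEQ_le_const) (use far in blast)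
    with L show False by simp
  qed
qed

section \<open>Inequalities between the constants, and assembly\<close>

theorem theorem4p1:
  fixes k :: nat and zs :: "real vec" and \<delta> \<gamma> \<nu> \<alpha> \<xi> :: real
  assumes "k \<ge> 1"
    and "zs \<in> carrier_vec k"
    and "0 < \<delta>" and "\<delta> \<le> real k * (2 * real k + 1)"
    and "\<nu> = sqrt ((1 + 1 / (4 * (real k)\<^sup>2 * (2 * real k + 1)\<^sup>2)) /
                   (1 + 1 / ((real k)\<^sup>2 * (2 * real k + 1)\<^sup>2)))"
    and "\<nu> \<le> \<gamma>" and "\<gamma> < 1"
    and "\<alpha> = \<gamma> * ((real k + 1) / real k)"
    and "\<xi> = \<gamma> * sqrt (1 + 1 / ((real k)\<^sup>2 * (2 * real k + 1)\<^sup>2))"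
  shows "\<nu> = sqrt ((4 * (real k)\<^sup>2 * (2 * real k + 1)\<^sup>2 + 1) /
                   (4 * (real k)\<^sup>2 * (2 * real k + 1)\<^sup>2 + 4)) \<and>
    (\<forall>v. is_arg_min (\<lambda>z. l1_norm (A_gamma k \<gamma> *\<^sub>v z - b_vec k \<gamma> zs \<delta>))
                    (\<lambda>z. z \<in> carrier_vec k) v \<longleftrightarrow> v = zs) \<and>
    \<alpha> > 1 \<and>
    \<xi> \<ge> sqrt (1 + 1 / (4 * (real k)\<^sup>2 * (2 * real k + 1)\<^sup>2)) \<and>
    sqrt (1 + 1 / (4 * (real k)\<^sup>2 * (2 * real k + 1)\<^sup>2)) > 1 \<and>
    \<gamma> / (real k * (2 * real k + 1) * sqrt (\<xi>\<^sup>2 - 1)) > 1 \<and>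
    (\<forall>z eps.
       l1R_IRLS (A_gamma k \<gamma>) (b_vec k \<gamma> zs \<delta>) k z eps \<and>
       eps 0 = 1 \<and>
       (\<forall>i<k. z 0 $ i > 0) \<and>
       z 0 $ 0 \<in> {zs $ 0 + \<delta> / (\<alpha> + \<gamma> / (real k * (2 * real k + 1) * sqrt (\<xi>\<^sup>2 - 1))) <..<
                  zs $ 0 + \<delta> / (\<alpha> + 1)} \<and>
       (\<forall>i\<in>{1..<k}. z 0 $ i = zs $ i)
       \<longrightarrow> \<not> converges_to z zs)"
proof -
  define N where "N = real k * (2 * real k + 1)"
  have NN: "(real k)\<^sup>2 * (2 * real k + 1)\<^sup>2 = N\<^sup>2" "4 * (real k)\<^sup>2 * (2 * real k + 1)\<^sup>2 = 4 * N\<^sup>2"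
    by (simp_all add: N_def power_mult_distrib)
  note \<nu> = assms(5)[unfolded NN] and \<xi> = assms(9)[unfolded NN]
  have k: "real k \<ge> 1" using assms(1) by simp
  have N3: "N \<ge> 3 * real k"
  proof -
    have "real k * 3 \<le> real k * (2 * real k + 1)" using k by (intro mult_left_mono) auto
    then show ?thesis by (simp add: N_def)
  qed
  then have N0: "N > 0" using k by simp
  have ratio: "(1 + 1 / (4 * N\<^sup>2)) / (1 + 1 / N\<^sup>2) = (4 * N\<^sup>2 + 1) / (4 * N\<^sup>2 + 4)"
    using N0 by (simp add: divide_simps add_eq_0_iff)
  then have \<nu>': "\<nu> = sqrt ((4 * N\<^sup>2 + 1) / (4 * N\<^sup>2 + 4))" unfolding \<nu> by simp
  have "\<nu> > 0" unfolding \<nu>' using N0 by (simp add: add_pos_pos)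
  then have \<gamma>0: "\<gamma> > 0" using assms(6) by linarith
  have \<gamma>2: "\<gamma>\<^sup>2 \<ge> (4 * N\<^sup>2 + 1) / (4 * N\<^sup>2 + 4)"
  proof -
    have "\<nu>\<^sup>2 \<le> \<gamma>\<^sup>2" using assms(6) \<open>\<nu> > 0\<close> by (intro power_mono) auto
    then show ?thesis unfolding \<nu>' by simp
  qed
  \<comment> \<open>The claim means \<open>\<gamma> > k / (k + 1)\<close>. Since \<gamma> exceeds
    its square, it suffices that \<open>\<nu>\<^sup>2 = 1 - 3 / (4 * N\<^sup>2 + 4)\<close> exceeds
    \<open>1 - 1 / (k + 1)\<close>, which \<open>N \<ge> 3 * k\<close> ensures.\<close>
  have "\<alpha> > 1"
  proof -
    have "9 * (real k)\<^sup>2 \<le> N\<^sup>2" using power_mono[OF N3, of 2] k by (simp add: power_mult_distrib)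
    moreover have "real k \<le> (real k)\<^sup>2" using k by (simp add: power2_eq_square)
    ultimately have "real k \<le> N\<^sup>2" using zero_le_power2[of "real k"] by linarith
    then have "3 * (real k + 1) < 4 * (N\<^sup>2 + 1)" using k by (simp add: algebra_simps)
    then have "real k / (real k + 1) < (4 * N\<^sup>2 + 1) / (4 * N\<^sup>2 + 4)"
      using k by (simp add: divide_simps add_pos_nonneg) (simp add: algebra_simps)
    also have "\<dots> \<le> \<gamma>\<^sup>2" by (rule \<gamma>2)
    also have "\<dots> < \<gamma>" using \<gamma>0 assms(7) by (simp add: power2_eq_square)
    finally show ?thesis using k by (simp add: assms(8) field_simps)
  qed
  have \<xi>2: "\<xi>\<^sup>2 = \<gamma>\<^sup>2 * (1 + 1 / N\<^sup>2)" by (simp add: \<xi> power_mult_distrib)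
  have "\<xi> \<ge> sqrt (1 + 1 / (4 * N\<^sup>2))"
  proof (rule real_le_lsqrt)
    \<comment> \<open>The value of \<nu> is exactly the one for which \<gamma> = \<nu> gives
      equality here.\<close>
    have "1 + 1 / (4 * N\<^sup>2) = (4 * N\<^sup>2 + 1) / (4 * N\<^sup>2 + 4) * (1 + 1 / N\<^sup>2)"
      unfolding ratio[symmetric] using add_pos_nonneg[of 1 "1 / N\<^sup>2"] by simp
    also have "\<dots> \<le> \<xi>\<^sup>2" unfolding \<xi>2 using \<gamma>2 by (intro mult_right_mono) auto
    finally show "1 + 1 / (4 * N\<^sup>2) \<le> \<xi>\<^sup>2" .
    show "0 \<le> \<xi>" using \<gamma>0 by (simp add: \<xi>)
  qed
  moreover have "sqrt (1 + 1 / (4 * N\<^sup>2)) > 1" using N0 by simp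
  ultimately have \<xi>1: "\<xi> > 1" by linarith
  have "\<gamma> / (N * sqrt (\<xi>\<^sup>2 - 1)) > 1"
  proof -
    have s: "\<xi>\<^sup>2 - 1 > 0" using \<xi>1 by simp
    have "\<gamma>\<^sup>2 < 1" using \<gamma>0 assms(7) by (simp add: power_less_one_iff)
    then have "\<gamma>\<^sup>2 * N\<^sup>2 < 1 * N\<^sup>2" using N0 by (intro mult_strict_right_mono) auto
    \<comment> \<open>The left side equals
      \<open>\<gamma>\<^sup>2 * (N\<^sup>2 + 1) - N\<^sup>2\<close>, so the claim is just \<gamma> <
      1. It makes the interval for the initial first coordinate nonempty.\<close>
    then have "N\<^sup>2 * (\<xi>\<^sup>2 - 1) < \<gamma>\<^sup>2" unfolding \<xi>2 using N0 by (simp add: field_simps)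
    then have "(N * sqrt (\<xi>\<^sup>2 - 1))\<^sup>2 < \<gamma>\<^sup>2" using s by (simp add: power_mult_distrib)
    then have "N * sqrt (\<xi>\<^sup>2 - 1) < \<gamma>" using \<gamma>0 by (intro power_less_imp_less_base[of _ 2 \<gamma>]) auto
    then show ?thesis using N0 s by simp
  qed
  moreover have "\<not> converges_to z zs"
    if "l1R_IRLS (A_gamma k \<gamma>) (b_vec k \<gamma> zs \<delta>) k z eps" "eps 0 = 1"
      "z 0 $ 0 \<in> {zs $ 0 + \<delta> / (\<alpha> + \<gamma> / (N * sqrt (\<xi>\<^sup>2 - 1))) <..< zs $ 0 + \<delta> / (\<alpha> + 1)}" for z eps
    using irls_not_convergent[OF assms(1,2,3) assms(4)[folded N_def] N_def \<gamma>0 assms(7,8) \<xi> \<xi>1 that] .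
  moreover note l1_regression_unique_solution[OF assms(1,2) less_imp_le[OF assms(3)] less_imp_le[OF \<gamma>0] assms(7)]
  ultimately show ?thesis
    unfolding NN N_def[symmetric]
    using \<nu>' \<open>\<alpha> > 1\<close> \<open>\<xi> \<ge> sqrt (1 + 1 / (4 * N\<^sup>2))\<close> \<open>sqrt (1 + 1 / (4 * N\<^sup>2)) > 1\<close> by blast
qed

end
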